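(* Let $(\Omega,\Sigma,\mu)$ be a positive, complete, $\sigma$-finite measure space, $(\Omega_\alpha)_{\alpha\in I}$ a countable measurable partition of $\Omega$, $X_\alpha$ ($\alpha\in I$) non-trivial quasi-normed ideal spaces over $(\Omega_\alpha,\Sigma_\alpha,\mu_\alpha)$ with moduli of concavity $C_\alpha$ satisfying $\sup_\alpha C_\alpha<\infty$, and $E$ a quasi-normed ideal space over the counting measure space $(I,2^I,m)$. Then the Köthe-Herz space $E(\mathcal X)$ has the Fatou property if and only if $E$ has the Fatou property and $X_\alpha$ has the Fatou property for every $\alpha\in I$.
   Context: A quasi-norm satisfies $\|x\|=0$ iff $x=0$, $\|ax\|=|a|\|x\|$, and $\|x+y\|\le C(\|x\|+\|y\|)$ for some $C\ge1$; the smallest such $C$ is the modulus of concavity. A quasi-normed ideal space over $(\Omega,\Sigma,\mu)$ is a linear subspace $E$ of $L^0(\Omega,\Sigma,\mu)$ (classes of real measurable functions) with a quasi-norm such that (i) if $f\in L^0$, $g\in E$, $|f|\le|g|$ a.e., then $f\in E$ and $\|f\|_E\le\|g\|_E$; (ii) there is $f\in E$ strictly positive on the whole of $\Omega$. It has the Fatou property if for any $f\in L^0$ and any sequence $(f_n)$ of nonnegative elements of $E$ with $f_n\uparrow|f|$ $\mu$-a.e. and $\sup_n\|f_n\|_E<\infty$, we have $f\in E$ and $\lim_n\|f_n\|_E=\|f\|_E$. Measurable partition: $\Omega_\alpha\in\Sigma$, $\Omega=\bigcup_{\alpha\in I}\Omega_\alpha$ $\mu$-a.e., $\mu(\Omega_\alpha\cap\Omega_\beta)=0$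 for $\alpha\ne\beta$; $\Sigma_\alpha=\{\Omega_\alpha\cap B:B\in\Sigma\}$, $\mu_\alpha=\mu|_{\Sigma_\alpha}$. Köthe-Herz space: $E(\mathcal X)=\{f\in L^0(\Omega,\Sigma,\mu): f\chi_{\Omega_\alpha}\in X_\alpha\text{ for each }\alpha\in I\text{ and }(\|f\chi_{\Omega_\alpha}\|_{X_\alpha})_\alpha\in E\}$, with $\|f\|_{E(\mathcal X)}=\left\|(\|f\chi_{\Omega_\alpha}\|_{X_\alpha})_\alpha\right\|_E$, where $\mathcal X=(X_\alpha)_{\alpha\in I}$. *)

theory Defs
  imports "HOL-Analysis.Analysis"
begin

text \<open>
  Elements of $L^0(M)$ are represented by measurable functions, and equality in $L^0(M)$ is
  equality almost everywhere. A function space over \<open>M\<close> is a set \<open>E\<close> of representatives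
  with a functional \<open>N\<close>, whose values outside \<open>E\<close> are irrelevant. For a quasi-normed
  ideal space, condition (i) makes \<open>E\<close> closed under equality almost everywhere and \<open>N\<close>
  constant on classes. Values of representatives outside \<open>space M\<close> play no role either, so
  a function on the whole type also represents a function on a subset of \<open>space M\<close>.
\<close>

definition linear_subspace_L0 :: "'a measure \<Rightarrow> ('a \<Rightarrow> real) set \<Rightarrow> bool" where
  "linear_subspace_L0 M E \<longleftrightarrow>
     E \<subseteq> borel_measurable M \<and>
     (\<lambda>x. 0) \<in> E \<and>
     (\<forall>f\<in>E. \<forall>g\<in>E. (\<lambda>x. f x + g x) \<in> E) \<and>
     (\<forall>a. \<forall>f\<in>E. (\<lambda>x. a * f x) \<in> E)"

definition concavity_bound :: "('a \<Rightarrow> real) set \<Rightarrow> (('a \<Rightarrow> real) \<Rightarrow> real) \<Rightarrow> real \<Rightarrow> bool" where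
  "concavity_bound E N C \<longleftrightarrow>
     1 \<le> C \<and> (\<forall>f\<in>E. \<forall>g\<in>E. N (\<lambda>x. f x + g x) \<le> C * (N f + N g))"

definition quasi_norm_on ::
  "'a measure \<Rightarrow> ('a \<Rightarrow> real) set \<Rightarrow> (('a \<Rightarrow> real) \<Rightarrow> real) \<Rightarrow> bool" where
  "quasi_norm_on M E N \<longleftrightarrow>
     (\<forall>f\<in>E. 0 \<le> N f) \<and>
     (\<forall>f\<in>E. N f = 0 \<longleftrightarrow> (AE x in M. f x = 0)) \<and>
     (\<forall>a. \<forall>f\<in>E. N (\<lambda>x. a * f x) = \<bar>a\<bar> * N f) \<and>
     (\<exists>C. concavity_bound E N C)"

definition modulus_of_concavity :: "('a \<Rightarrow> real) set \<Rightarrow> (('a \<Rightarrow> real) \<Rightarrow> real) \<Rightarrow> real" where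
  "modulus_of_concavity E N = (LEAST C. concavity_bound E N C)"

definition quasi_normed_ideal_space ::
  "'a measure \<Rightarrow> ('a \<Rightarrow> real) set \<Rightarrow> (('a \<Rightarrow> real) \<Rightarrow> real) \<Rightarrow> bool" where
  "quasi_normed_ideal_space M E N \<longleftrightarrow>
     linear_subspace_L0 M E \<and>
     quasi_norm_on M E N \<and>
     (\<forall>f\<in>borel_measurable M. \<forall>g\<in>E.
        (AE x in M. \<bar>f x\<bar> \<le> \<bar>g x\<bar>) \<longrightarrow> f \<in> E \<and> N f \<le> N g) \<and>
     (\<exists>f\<in>E. \<forall>x\<in>space M. 0 < f x)"

definition nontrivial_space :: "'a measure \<Rightarrow> ('a \<Rightarrow> real) set \<Rightarrow> bool" where
  "nontrivial_space M E \<longleftrightarrow> (\<exists>f\<in>E. \<not> (AE x in M. f x = 0))"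

definition Fatou_property ::
  "'a measure \<Rightarrow> ('a \<Rightarrow> real) set \<Rightarrow> (('a \<Rightarrow> real) \<Rightarrow> real) \<Rightarrow> bool" where
  "Fatou_property M E N \<longleftrightarrow>
     (\<forall>f\<in>borel_measurable M. \<forall>F :: nat \<Rightarrow> 'a \<Rightarrow> real.
        (\<forall>n. F n \<in> E \<and> (AE x in M. 0 \<le> F n x)) \<longrightarrow>
        (AE x in M. incseq (\<lambda>n. F n x) \<and> (\<lambda>n. F n x) \<longlonglongrightarrow> \<bar>f x\<bar>) \<longrightarrow>
        bdd_above (range (\<lambda>n. N (F n))) \<longrightarrow>
        f \<in> E \<and> (\<lambda>n. N (F n)) \<longlonglongrightarrow> N f)"

definition measurable_partition :: "'a measure \<Rightarrow> 'i set \<Rightarrow> ('i \<Rightarrow> 'a set) \<Rightarrow> bool" where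
  "measurable_partition M I \<Omega> \<longleftrightarrow>
     (\<forall>\<alpha>\<in>I. \<Omega> \<alpha> \<in> sets M) \<and>
     (AE x in M. x \<in> (\<Union>\<alpha>\<in>I. \<Omega> \<alpha>)) \<and>
     (\<forall>\<alpha>\<in>I. \<forall>\<beta>\<in>I. \<alpha> \<noteq> \<beta> \<longrightarrow> emeasure M (\<Omega> \<alpha> \<inter> \<Omega> \<beta>) = 0)"

definition block_norms ::
  "('i \<Rightarrow> 'a set) \<Rightarrow> ('i \<Rightarrow> ('a \<Rightarrow> real) \<Rightarrow> real) \<Rightarrow> ('a \<Rightarrow> real) \<Rightarrow> 'i \<Rightarrow> real" where
  "block_norms \<Omega> NX f = (\<lambda>\<alpha>. NX \<alpha> (\<lambda>x. f x * indicator (\<Omega> \<alpha>) x))"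

definition Koethe_Herz_space ::
  "'a measure \<Rightarrow> 'i set \<Rightarrow> ('i \<Rightarrow> 'a set) \<Rightarrow> ('i \<Rightarrow> real) set \<Rightarrow>
   ('i \<Rightarrow> ('a \<Rightarrow> real) set) \<Rightarrow> ('i \<Rightarrow> ('a \<Rightarrow> real) \<Rightarrow> real) \<Rightarrow> ('a \<Rightarrow> real) set" where
  "Koethe_Herz_space M I \<Omega> E X NX =
     {f \<in> borel_measurable M.
        (\<forall>\<alpha>\<in>I. (\<lambda>x. f x * indicator (\<Omega> \<alpha>) x) \<in> X \<alpha>) \<and> block_norms \<Omega> NX f \<in> E}"

definition Koethe_Herz_norm ::
  "('i \<Rightarrow> 'a set) \<Rightarrow> (('i \<Rightarrow> real) \<Rightarrow> real) \<Rightarrow>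
   ('i \<Rightarrow> ('a \<Rightarrow> real) \<Rightarrow> real) \<Rightarrow> ('a \<Rightarrow> real) \<Rightarrow> real" where
  "Koethe_Herz_norm \<Omega> NE NX f = NE (block_norms \<Omega> NX f)"

end

theory Submission
  imports Defs
begin

text \<open>
  The block norms turn pointwise statements about \<open>f\<close> into pointwise statements about the
  sequence \<open>b f = (\<parallel>f \<chi>\<^sub>\<alpha>\<parallel>)\<^sub>\<alpha>\<close>, and the three Fatou properties are compared along this map.

  If \<open>E\<close> and all \<open>X\<^sub>\<alpha>\<close> have the Fatou property and \<open>0 \<le> F\<^sub>n \<up> \<bar>f\<bar>\<close> with bounded norms, then for
  each \<open>\<alpha>\<close> the coordinate \<open>b F\<^sub>n \<alpha>\<close> is bounded in \<open>n\<close>: the unit vector \<open>e\<^sub>\<alpha>\<close> lies in \<open>E\<close> and has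
  positive norm, and a coordinate of a member of \<open>E\<close> is at most its norm divided by the norm of
  \<open>e\<^sub>\<alpha>\<close> (\<open>ideal_space_coordinate_bound\<close>). The Fatou property of \<open>X\<^sub>\<alpha>\<close> gives \<open>b F\<^sub>n \<alpha> \<up> b f \<alpha>\<close>, and
  the Fatou property of \<open>E\<close> applied to \<open>b F\<^sub>n \<up> b f\<close> finishes this direction.

  Conversely, both \<open>E\<close> and each \<open>X\<^sub>\<alpha>\<close> embed into the Koethe-Herz space compatibly with order,
  limits and norms, so they inherit the property. A sequence \<open>g\<close> is sent to the function that
  equals \<open>g \<alpha> \<cdot> u\<^sub>\<alpha>\<close> on the block \<open>\<alpha>\<close>, where \<open>u\<^sub>\<alpha> \<ge> 0\<close> is a norm-one member of \<open>X\<^sub>\<alpha>\<close>; its block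
  norms are \<open>\<bar>g \<alpha>\<bar>\<close>. A function \<open>v \<in> X\<^sub>\<alpha>\<close> is extended by zero; its block norms are
  \<open>\<parallel>v\<parallel> e\<^sub>\<alpha>\<close>, so the embedding multiplies the norm by the positive constant \<open>\<parallel>e\<^sub>\<alpha>\<parallel>\<close>.
  Blocks may overlap in null sets; \<open>glue_on_partition\<close> provides measurable functions with
  prescribed restrictions nevertheless.
\<close>

section \<open>Quasi-normed ideal spaces\<close>

lemma ideal_spaceD:
  assumes "quasi_normed_ideal_space M E N" "f \<in> borel_measurable M" "g \<in> E"
    and "AE x in M. \<bar>f x\<bar> \<le> \<bar>g x\<bar>"
  shows "f \<in> E" and "N f \<le> N g"
  using assms unfolding quasi_normed_ideal_space_def by blast+

lemma ideal_space_AE_abs_eq: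
  assumes E: "quasi_normed_ideal_space M E N" and f: "f \<in> borel_measurable M" and g: "g \<in> E"
    and eq: "AE x in M. \<bar>f x\<bar> = \<bar>g x\<bar>"
  shows "f \<in> E" and "N f = N g"
proof -
  have gm: "g \<in> borel_measurable M"
    using E g unfolding quasi_normed_ideal_space_def linear_subspace_L0_def by blast
  have le: "AE x in M. \<bar>f x\<bar> \<le> \<bar>g x\<bar>" and ge: "AE x in M. \<bar>g x\<bar> \<le> \<bar>f x\<bar>"
    using eq by auto
  show fE: "f \<in> E"
    using ideal_spaceD(1)[OF E f g le] .
  show "N f = N g"
    using ideal_spaceD(2)[OF E f g le] ideal_spaceD(2)[OF E gm fE ge] by simp
qed

lemma ideal_space_facts:
  assumes "quasi_normed_ideal_space M E N"
  shows ideal_space_measurable: "f \<in> E \<Longrightarrow> f \<in> borel_measurable M"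
    and ideal_space_zero: "(\<lambda>x. 0) \<in> E"
    and ideal_space_scale: "f \<in> E \<Longrightarrow> (\<lambda>x. a * f x) \<in> E"
    and ideal_space_norm_nonneg: "f \<in> E \<Longrightarrow> 0 \<le> N f"
    and ideal_space_norm_zero_iff: "f \<in> E \<Longrightarrow> N f = 0 \<longleftrightarrow> (AE x in M. f x = 0)"
    and ideal_space_norm_scale: "f \<in> E \<Longrightarrow> N (\<lambda>x. a * f x) = \<bar>a\<bar> * N f"
  using assms
  unfolding quasi_normed_ideal_space_def linear_subspace_L0_def quasi_norm_on_def by blast+

text \<open>
  A multiple of the everywhere positive member of \<open>E\<close> dominates the unit vector. Its norm does
  not vanish, since a point is not null for the counting measure.
\<close>
lemma ideal_space_unit_vector:
  assumes E: "quasi_normed_ideal_space (count_space I) E N" and \<alpha>: "\<alpha> \<in> I"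
  shows "indicator {\<alpha>} \<in> E" and "0 < N (indicator {\<alpha>})"
proof -
  obtain w where w: "w \<in> E" "\<And>\<beta>. \<beta> \<in> I \<Longrightarrow> 0 < w \<beta>"
    using E unfolding quasi_normed_ideal_space_def by auto
  have scaled: "(\<lambda>\<beta>. inverse (w \<alpha>) * w \<beta>) \<in> E"
    by (rule ideal_space_scale[OF E w(1)])
  have "AE \<beta> in count_space I. \<bar>indicator {\<alpha>} \<beta>\<bar> \<le> \<bar>inverse (w \<alpha>) * w \<beta>\<bar>"
    using w(2)[OF \<alpha>] by (auto simp: AE_count_space indicator_def)
  then show e: "indicator {\<alpha>} \<in> E"
    by (intro ideal_spaceD(1)[OF E _ scaled]) simp_all
  have "N (indicator {\<alpha>}) \<noteq> 0"
    using ideal_space_norm_zero_iff[OF E e] \<alpha> by (auto simp: AE_count_space)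
  then show "0 < N (indicator {\<alpha>})"
    using ideal_space_norm_nonneg[OF E e] by simp
qed

lemma ideal_space_coordinate_bound:
  assumes E: "quasi_normed_ideal_space (count_space I) E N" and \<alpha>: "\<alpha> \<in> I" and b: "b \<in> E"
  shows "\<bar>b \<alpha>\<bar> \<le> N b / N (indicator {\<alpha>})"
proof -
  note e = ideal_space_unit_vector[OF E \<alpha>]
  have "\<bar>b \<alpha>\<bar> * N (indicator {\<alpha>}) = N (\<lambda>\<beta>. b \<alpha> * indicator {\<alpha>} \<beta>)"
    by (simp add: ideal_space_norm_scale[OF E e(1)])
  also have "\<dots> \<le> N b"
    by (rule ideal_spaceD(2)[OF E _ b]) (auto simp: AE_count_space indicator_def)
  finally show ?thesis
    using e(2) by (simp add: field_simps)
qed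

lemma ideal_space_nonneg_unit:
  assumes X: "quasi_normed_ideal_space M X N" and nt: "nontrivial_space M X"
  obtains u where "u \<in> X" "\<And>x. 0 \<le> u x" "N u = 1"
proof -
  obtain f where f: "f \<in> X" "\<not> (AE x in M. f x = 0)"
    using nt unfolding nontrivial_space_def by blast
  have fm: "f \<in> borel_measurable M"
    by (rule ideal_space_measurable[OF X f(1)])
  have pos: "0 < N f"
    using ideal_space_norm_zero_iff[OF X f(1)] ideal_space_norm_nonneg[OF X f(1)] f(2) by simp
  have absf: "(\<lambda>x. \<bar>f x\<bar>) \<in> X" "N (\<lambda>x. \<bar>f x\<bar>) = N f"
    using fm by (auto intro!: ideal_space_AE_abs_eq[OF X _ f(1)])
  show thesis
  proof (rule that)
    show "(\<lambda>x. inverse (N f) * \<bar>f x\<bar>) \<in> X"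
      by (rule ideal_space_scale[OF X absf(1)])
    show "N (\<lambda>x. inverse (N f) * \<bar>f x\<bar>) = 1"
      using pos by (simp add: ideal_space_norm_scale[OF X absf(1)] absf(2))
    show "0 \<le> inverse (N f) * \<bar>f x\<bar>" for x
      using pos by simp
  qed
qed

lemma FatouI:
  assumes "\<And>f F. \<lbrakk>f \<in> borel_measurable M; \<And>n. F n \<in> E; \<And>n. AE x in M. 0 \<le> F n x;
      AE x in M. incseq (\<lambda>n. F n x) \<and> (\<lambda>n. F n x) \<longlonglongrightarrow> \<bar>f x\<bar>;
      bdd_above (range (\<lambda>n. N (F n)))\<rbrakk> \<Longrightarrow> f \<in> E \<and> (\<lambda>n. N (F n)) \<longlonglongrightarrow> N f"
  shows "Fatou_property M E N"
  unfolding Fatou_property_def using assms by blast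

lemma FatouD:
  fixes F :: "nat \<Rightarrow> 'a \<Rightarrow> real"
  assumes "Fatou_property M E N" "f \<in> borel_measurable M" "\<And>n. F n \<in> E"
    and "\<And>n. AE x in M. 0 \<le> F n x"
    and "AE x in M. incseq (\<lambda>n. F n x) \<and> (\<lambda>n. F n x) \<longlonglongrightarrow> \<bar>f x\<bar>"
    and "bdd_above (range (\<lambda>n. N (F n)))"
  shows "f \<in> E" and "(\<lambda>n. N (F n)) \<longlonglongrightarrow> N f"
  using assms unfolding Fatou_property_def by blast+

section \<open>Measurable partitions\<close>

lemma AE_on_partition_iff:
  assumes I: "countable I" and P: "measurable_partition M I \<Omega>"
  shows "(AE x in M. Q x) \<longleftrightarrow> (\<forall>\<alpha>\<in>I. AE x in restrict_space M (\<Omega> \<alpha>). Q x)"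
proof -
  have "(\<forall>\<alpha>\<in>I. AE x in restrict_space M (\<Omega> \<alpha>). Q x) \<longleftrightarrow> (\<forall>\<alpha>\<in>I. AE x in M. x \<in> \<Omega> \<alpha> \<longrightarrow> Q x)"
    using P unfolding measurable_partition_def by (intro ball_cong) (auto simp: AE_restrict_space_iff)
  also have "\<dots> \<longleftrightarrow> (AE x in M. \<forall>\<alpha>\<in>I. x \<in> \<Omega> \<alpha> \<longrightarrow> Q x)"
    by (rule AE_ball_countable[OF I, symmetric])
  also have "\<dots> \<longleftrightarrow> (AE x in M. Q x)"
  proof -
    have "AE x in M. x \<in> (\<Union>\<alpha>\<in>I. \<Omega> \<alpha>)"
      using P unfolding measurable_partition_def by blast
    then have "AE x in M. (\<forall>\<alpha>\<in>I. x \<in> \<Omega> \<alpha> \<longrightarrow> Q x) \<longleftrightarrow> Q x"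
      by eventually_elim auto
    then show ?thesis
      by (rule eventually_subst)
  qed
  finally show ?thesis by simp
qed

lemma AE_not_in_other_block:
  assumes P: "measurable_partition M I \<Omega>" and "\<alpha> \<in> I" "\<beta> \<in> I" "\<alpha> \<noteq> \<beta>"
  shows "AE x in restrict_space M (\<Omega> \<alpha>). x \<notin> \<Omega> \<beta>"
proof -
  have s: "\<Omega> \<alpha> \<in> sets M" "\<Omega> \<beta> \<in> sets M" and "emeasure M (\<Omega> \<alpha> \<inter> \<Omega> \<beta>) = 0"
    using assms unfolding measurable_partition_def by blast+
  then have "\<Omega> \<alpha> \<inter> \<Omega> \<beta> \<in> null_sets M"
    by (auto simp: null_sets_def)
  then have "AE x in M. x \<notin> \<Omega> \<alpha> \<inter> \<Omega> \<beta>"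
    by (rule AE_not_in)
  then show ?thesis
    using s by (auto simp: AE_restrict_space_iff)
qed

text \<open>
  Removing from each block the points shared with another one makes the blocks disjoint and, as
  \<open>I\<close> is countable, changes them by null sets only. On the reduced blocks the pieces can be pasted
  together without conflict.
\<close>
lemma glue_on_partition:
  fixes v :: "'i \<Rightarrow> 'a \<Rightarrow> real"
  assumes I: "countable I" and P: "measurable_partition M I \<Omega>"
    and v: "\<And>\<alpha>. \<alpha> \<in> I \<Longrightarrow> v \<alpha> \<in> borel_measurable (restrict_space M (\<Omega> \<alpha>))"
  obtains h where "h \<in> borel_measurable M"
    and "\<And>\<alpha>. \<alpha> \<in> I \<Longrightarrow> AE x in restrict_space M (\<Omega> \<alpha>). h x = v \<alpha> x"
proof -
  define D where "D \<alpha> = \<Omega> \<alpha> - (\<Union>\<beta>\<in>I - {\<alpha>}. \<Omega> \<beta>)" for \<alpha>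
  define h where "h x = (if \<exists>\<alpha>\<in>I. x \<in> D \<alpha> then v (THE \<alpha>. \<alpha> \<in> I \<and> x \<in> D \<alpha>) x else 0)" for x
  have \<Omega>: "\<Omega> \<alpha> \<in> sets M" if "\<alpha> \<in> I" for \<alpha>
    using P that unfolding measurable_partition_def by blast
  have D: "D \<alpha> \<in> sets M" if "\<alpha> \<in> I" for \<alpha>
    unfolding D_def using I \<Omega> that by (intro sets.Diff sets.countable_UN') auto
  have h_D: "h x = v \<alpha> x" if "\<alpha> \<in> I" "x \<in> D \<alpha>" for x \<alpha>
  proof -
    have "(THE \<alpha>. \<alpha> \<in> I \<and> x \<in> D \<alpha>) = \<alpha>"
      using that by (intro the_equality) (auto simp: D_def)
    with that show ?thesis
      by (auto simp: h_def)
  qed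
  define R where "R = space M - (\<Union>\<alpha>\<in>I. D \<alpha>)"
  have R: "R \<in> sets M"
    unfolding R_def using I D by (intro sets.Diff sets.countable_UN') auto
  have meas: "h \<in> borel_measurable M"
  proof (rule measurable_piecewise_restrict[where C = "insert R (D ` I)"])
    show "countable (insert R (D ` I))"
      using I by simp
    show "space M \<subseteq> \<Union> (insert R (D ` I))"
      by (auto simp: R_def)
    fix A assume A: "A \<in> insert R (D ` I)"
    then show "A \<inter> space M \<in> sets M"
      using R D by auto
    show "h \<in> borel_measurable (restrict_space M A)"
    proof (cases "A = R")
      case True
      have "h x = 0" if "x \<in> space (restrict_space M R)" for x
        using that by (auto simp: h_def R_def space_restrict_space)
      then have "h \<in> borel_measurable (restrict_space M R) \<longleftrightarrow>
          (\<lambda>x. 0 :: real) \<in> borel_measurable (restrict_space M R)"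
        by (rule measurable_cong)
      with True show ?thesis
        by simp
    next
      case False
      with A obtain \<alpha> where \<alpha>: "\<alpha> \<in> I" "A = D \<alpha>"
        by auto
      have "D \<alpha> \<subseteq> \<Omega> \<alpha>"
        by (auto simp: D_def)
      then have "v \<alpha> \<in> borel_measurable (restrict_space M (D \<alpha>))"
        by (metis measurable_restrict_mono v[OF \<alpha>(1)])
      moreover have "h \<in> borel_measurable (restrict_space M (D \<alpha>)) \<longleftrightarrow>
          v \<alpha> \<in> borel_measurable (restrict_space M (D \<alpha>))"
        by (rule measurable_cong) (simp add: h_D[OF \<alpha>(1)] space_restrict_space)
      ultimately show ?thesis
        using \<alpha>(2) by simp
    qed
  qed
  have "AE x in restrict_space M (\<Omega> \<alpha>). h x = v \<alpha> x" if \<alpha>: "\<alpha> \<in> I" for \<alpha>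
  proof -
    have "AE x in restrict_space M (\<Omega> \<alpha>). \<forall>\<beta>\<in>I - {\<alpha>}. x \<notin> \<Omega> \<beta>"
      using I AE_not_in_other_block[OF P \<alpha>] by (subst AE_ball_countable) auto
    moreover have "AE x in restrict_space M (\<Omega> \<alpha>). x \<in> \<Omega> \<alpha>"
      by (rule AE_I2) (simp add: space_restrict_space)
    ultimately show ?thesis
      by eventually_elim (use h_D[OF \<alpha>] in \<open>auto simp: D_def\<close>)
  qed
  with meas show thesis
    by (rule that)
qed

section \<open>Fatou property of Koethe-Herz spaces\<close>

locale koethe_herz =
  fixes M :: "'a measure"
    and I :: "'i set"
    and \<Omega> :: "'i \<Rightarrow> 'a set"
    and X :: "'i \<Rightarrow> ('a \<Rightarrow> real) set"
    and NX :: "'i \<Rightarrow> ('a \<Rightarrow> real) \<Rightarrow> real"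
    and E :: "('i \<Rightarrow> real) set"
    and NE :: "('i \<Rightarrow> real) \<Rightarrow> real"
  assumes I: "countable I"
    and partition: "measurable_partition M I \<Omega>"
    and X: "\<And>\<alpha>. \<alpha> \<in> I \<Longrightarrow> quasi_normed_ideal_space (restrict_space M (\<Omega> \<alpha>)) (X \<alpha>) (NX \<alpha>)"
    and E: "quasi_normed_ideal_space (count_space I) E NE"
begin

abbreviation "KH \<equiv> Koethe_Herz_space M I \<Omega> E X NX"
abbreviation "NKH \<equiv> Koethe_Herz_norm \<Omega> NE NX"
abbreviation "block \<alpha> \<equiv> restrict_space M (\<Omega> \<alpha>)"

lemma block_sets: "\<alpha> \<in> I \<Longrightarrow> \<Omega> \<alpha> \<in> sets M"
  using partition unfolding measurable_partition_def by blast

lemma AE_in_block: "AE x in block \<alpha>. x \<in> \<Omega> \<alpha>"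
  by (rule AE_I2) (simp add: space_restrict_space)

lemma cut_measurable:
  fixes f :: "'a \<Rightarrow> real"
  assumes "\<alpha> \<in> I" "f \<in> borel_measurable M"
  shows "(\<lambda>x. f x * indicator (\<Omega> \<alpha>) x) \<in> borel_measurable (block \<alpha>)"
  using assms block_sets by (intro measurable_restrict_space1) auto

text \<open>
  Only the class of \<open>f\<close> on a block matters for the block norm, so it can be computed from any
  representative \<open>v\<close> there.
\<close>
lemma block_norm_eq:
  assumes \<alpha>: "\<alpha> \<in> I" and f: "f \<in> borel_measurable M" and v: "v \<in> X \<alpha>"
    and eq: "AE x in block \<alpha>. \<bar>f x\<bar> = \<bar>v x\<bar>"
  shows "(\<lambda>x. f x * indicator (\<Omega> \<alpha>) x) \<in> X \<alpha>" and "block_norms \<Omega> NX f \<alpha> = NX \<alpha> v"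
proof -
  have "AE x in block \<alpha>. \<bar>f x * indicator (\<Omega> \<alpha>) x\<bar> = \<bar>v x\<bar>"
    using eq AE_in_block by eventually_elim simp
  note * = ideal_space_AE_abs_eq[OF X[OF \<alpha>] cut_measurable[OF \<alpha> f] v this]
  show "(\<lambda>x. f x * indicator (\<Omega> \<alpha>) x) \<in> X \<alpha>" "block_norms \<Omega> NX f \<alpha> = NX \<alpha> v"
    using * by (simp_all add: block_norms_def)
qed

text \<open>
  Since \<open>E\<close> sees only absolute values at the points of \<open>I\<close>, the block norms may be replaced by
  any more convenient sequence that has these absolute values there.
\<close>
lemma KHI:
  assumes f: "f \<in> borel_measurable M" and cut: "\<And>\<alpha>. \<alpha> \<in> I \<Longrightarrow> (\<lambda>x. f x * indicator (\<Omega> \<alpha>) x) \<in> X \<alpha>"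
    and g: "g \<in> E" and eq: "\<And>\<alpha>. \<alpha> \<in> I \<Longrightarrow> block_norms \<Omega> NX f \<alpha> = \<bar>g \<alpha>\<bar>"
  shows "f \<in> KH" and "NKH f = NE g"
proof -
  have "AE \<alpha> in count_space I. \<bar>block_norms \<Omega> NX f \<alpha>\<bar> = \<bar>g \<alpha>\<bar>"
    using eq by (simp add: AE_count_space)
  note * = ideal_space_AE_abs_eq[OF E _ g this]
  show "f \<in> KH" "NKH f = NE g"
    using * f cut by (simp_all add: Koethe_Herz_space_def Koethe_Herz_norm_def)
qed

lemma KHD:
  assumes "f \<in> KH"
  shows "f \<in> borel_measurable M" "\<And>\<alpha>. \<alpha> \<in> I \<Longrightarrow> (\<lambda>x. f x * indicator (\<Omega> \<alpha>) x) \<in> X \<alpha>"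
    and "block_norms \<Omega> NX f \<in> E"
  using assms unfolding Koethe_Herz_space_def by auto

text \<open>
  The hypothesis bounds only the \<open>E\<close>-norms of the sequences of block norms; the coordinate
  bound turns this into the bound in each \<open>X\<^sub>\<alpha>\<close> that its Fatou property asks for.
\<close>
theorem Fatou_KH:
  assumes FE: "Fatou_property (count_space I) E NE"
    and FX: "\<And>\<alpha>. \<alpha> \<in> I \<Longrightarrow> Fatou_property (block \<alpha>) (X \<alpha>) (NX \<alpha>)"
  shows "Fatou_property M KH NKH"
proof (rule FatouI)
  fix f and F :: "nat \<Rightarrow> 'a \<Rightarrow> real"
  assume f: "f \<in> borel_measurable M" and F: "\<And>n. F n \<in> KH"
    and nonneg: "\<And>n. AE x in M. 0 \<le> F n x"
    and lim: "AE x in M. incseq (\<lambda>n. F n x) \<and> (\<lambda>n. F n x) \<longlonglongrightarrow> \<bar>f x\<bar>"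
    and bdd: "bdd_above (range (\<lambda>n. NKH (F n)))"
  let ?b = "block_norms \<Omega> NX"
  obtain K where K: "\<And>n. NE (?b (F n)) \<le> K"
    using bdd unfolding bdd_above_def Koethe_Herz_norm_def by auto
  have AE_blockI: "AE x in block \<alpha>. Q x" if "\<alpha> \<in> I" "AE x in M. Q x" for \<alpha> Q
    using that AE_on_partition_iff[OF I partition] by blast
  have blockwise: "(\<lambda>x. f x * indicator (\<Omega> \<alpha>) x) \<in> X \<alpha> \<and> (\<lambda>n. ?b (F n) \<alpha>) \<longlonglongrightarrow> ?b f \<alpha>
      \<and> incseq (\<lambda>n. ?b (F n) \<alpha>) \<and> (\<forall>n. 0 \<le> ?b (F n) \<alpha>) \<and> 0 \<le> ?b f \<alpha>" if \<alpha>: "\<alpha> \<in> I" for \<alpha>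
  proof -
    note nonneg' = AE_blockI[OF \<alpha> nonneg] and lim' = AE_blockI[OF \<alpha> lim]
    note cut = KHD(2)[OF F \<alpha>]
    have "?b (F n) \<alpha> \<le> K / NE (indicator {\<alpha>})" for n
    proof -
      have "?b (F n) \<alpha> \<le> NE (?b (F n)) / NE (indicator {\<alpha>})"
        using ideal_space_coordinate_bound[OF E \<alpha> KHD(3)[OF F, of n]] by simp
      also have "\<dots> \<le> K / NE (indicator {\<alpha>})"
        using ideal_space_unit_vector(2)[OF E \<alpha>] K by (intro divide_right_mono) auto
      finally show ?thesis .
    qed
    then have bdd': "bdd_above (range (\<lambda>n. NX \<alpha> (\<lambda>x. F n x * indicator (\<Omega> \<alpha>) x)))"
      by (auto simp: bdd_above_def block_norms_def)
    have n0: "AE x in block \<alpha>. 0 \<le> F n x * indicator (\<Omega> \<alpha>) x" for n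
      using nonneg'[of n] by eventually_elim simp
    have l0: "AE x in block \<alpha>. incseq (\<lambda>n. F n x * indicator (\<Omega> \<alpha>) x) \<and>
        (\<lambda>n. F n x * indicator (\<Omega> \<alpha>) x) \<longlonglongrightarrow> \<bar>f x * indicator (\<Omega> \<alpha>) x\<bar>"
      using lim' AE_in_block by eventually_elim simp
    note * = FatouD[where F = "\<lambda>n x. F n x * indicator (\<Omega> \<alpha>) x",
        OF FX[OF \<alpha>] cut_measurable[OF \<alpha> f] cut n0 l0 bdd']
    have inc: "incseq (\<lambda>n. ?b (F n) \<alpha>)"
    proof (rule incseq_SucI)
      fix n
      have "AE x in block \<alpha>. \<bar>F n x * indicator (\<Omega> \<alpha>) x\<bar> \<le> \<bar>F (Suc n) x * indicator (\<Omega> \<alpha>) x\<bar>"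
        using n0[of n] l0
      proof eventually_elim
        case (elim x)
        then have "F n x * indicator (\<Omega> \<alpha>) x \<le> F (Suc n) x * indicator (\<Omega> \<alpha>) x"
          using incseq_SucD[of "\<lambda>n. F n x * indicator (\<Omega> \<alpha>) x" n] by blast
        with elim(1) show ?case by linarith
      qed
      from ideal_spaceD(2)[OF X[OF \<alpha>] ideal_space_measurable[OF X[OF \<alpha>] cut] cut this]
      show "?b (F n) \<alpha> \<le> ?b (F (Suc n)) \<alpha>"
        by (simp add: block_norms_def)
    qed
    show ?thesis
      using * inc ideal_space_norm_nonneg[OF X[OF \<alpha>]] cut by (simp add: block_norms_def)
  qed
  have "?b f \<in> E" "(\<lambda>n. NE (?b (F n))) \<longlonglongrightarrow> NE (?b f)"
    by (rule FatouD[OF FE _ KHD(3)[OF F]];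
        use blockwise bdd in \<open>simp add: AE_count_space Koethe_Herz_norm_def\<close>)+
  then show "f \<in> KH \<and> (\<lambda>n. NKH (F n)) \<longlonglongrightarrow> NKH f"
    using f blockwise by (simp add: Koethe_Herz_space_def Koethe_Herz_norm_def)
qed

text \<open>
  Nontriviality of the blocks makes every sequence in \<open>E\<close> occur, up to signs, as a sequence of
  block norms; if some \<open>X\<^sub>\<alpha>\<close> were trivial, the coordinate \<open>\<alpha>\<close> of \<open>E\<close> would be invisible in
  the space.
\<close>
theorem Fatou_sequence_space:
  assumes FKH: "Fatou_property M KH NKH"
    and nt: "\<And>\<alpha>. \<alpha> \<in> I \<Longrightarrow> nontrivial_space (block \<alpha>) (X \<alpha>)"
  shows "Fatou_property (count_space I) E NE"
proof (rule FatouI)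
  fix g and G :: "nat \<Rightarrow> 'i \<Rightarrow> real"
  assume G: "\<And>n. G n \<in> E" and nonneg: "\<And>n. AE \<alpha> in count_space I. 0 \<le> G n \<alpha>"
    and lim: "AE \<alpha> in count_space I. incseq (\<lambda>n. G n \<alpha>) \<and> (\<lambda>n. G n \<alpha>) \<longlonglongrightarrow> \<bar>g \<alpha>\<bar>"
    and bdd: "bdd_above (range (\<lambda>n. NE (G n)))"
  have "\<forall>\<alpha>\<in>I. \<exists>u\<in>X \<alpha>. (\<forall>x. 0 \<le> u x) \<and> NX \<alpha> u = 1"
    using ideal_space_nonneg_unit[OF X nt] by metis
  then obtain u where u: "\<And>\<alpha>. \<alpha> \<in> I \<Longrightarrow> u \<alpha> \<in> X \<alpha>" "\<And>\<alpha> x. \<alpha> \<in> I \<Longrightarrow> 0 \<le> u \<alpha> x"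
      "\<And>\<alpha>. \<alpha> \<in> I \<Longrightarrow> NX \<alpha> (u \<alpha>) = 1"
    by metis
  \<comment> \<open>\<open>\<Phi>\<close> is the norm-preserving embedding of sequences as blockwise multiples of \<open>u\<close>.\<close>
  have "\<exists>h \<in> borel_measurable M. \<forall>\<alpha>\<in>I. AE x in block \<alpha>. h x = c \<alpha> * u \<alpha> x" for c
    by (rule glue_on_partition[OF I partition, of "\<lambda>\<alpha> x. c \<alpha> * u \<alpha> x"])
      (auto intro!: borel_measurable_times ideal_space_measurable[OF X u(1)])
  then obtain \<Phi> where \<Phi>_meas: "\<And>c. \<Phi> c \<in> borel_measurable M"
    and \<Phi>: "\<And>c \<alpha>. \<alpha> \<in> I \<Longrightarrow> AE x in block \<alpha>. \<Phi> c x = c \<alpha> * u \<alpha> x"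
    by metis
  have \<Phi>_block: "(\<lambda>x. \<Phi> c x * indicator (\<Omega> \<alpha>) x) \<in> X \<alpha>" "block_norms \<Omega> NX (\<Phi> c) \<alpha> = \<bar>c \<alpha>\<bar>"
    if \<alpha>: "\<alpha> \<in> I" for c \<alpha>
  proof -
    have "AE x in block \<alpha>. \<bar>\<Phi> c x\<bar> = \<bar>c \<alpha> * u \<alpha> x\<bar>"
      using \<Phi>[OF \<alpha>, of c] by eventually_elim simp
    note * = block_norm_eq[OF \<alpha> \<Phi>_meas ideal_space_scale[OF X[OF \<alpha>] u(1)[OF \<alpha>]] this]
    show "(\<lambda>x. \<Phi> c x * indicator (\<Omega> \<alpha>) x) \<in> X \<alpha>" "block_norms \<Omega> NX (\<Phi> c) \<alpha> = \<bar>c \<alpha>\<bar>"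
      using * u(3)[OF \<alpha>] by (simp_all add: ideal_space_norm_scale[OF X[OF \<alpha>] u(1)[OF \<alpha>]])
  qed
  have \<Phi>_KH: "\<Phi> c \<in> KH" "NKH (\<Phi> c) = NE c" if "c \<in> E" for c
    using KHI[OF \<Phi>_meas \<Phi>_block(1) that \<Phi>_block(2)] by auto
  have pos: "AE x in M. 0 \<le> \<Phi> (G n) x" for n
    unfolding AE_on_partition_iff[OF I partition]
  proof
    fix \<alpha> assume \<alpha>: "\<alpha> \<in> I"
    with nonneg have Gn: "0 \<le> G n \<alpha>" by (simp add: AE_count_space)
    from \<Phi>[OF \<alpha>, of "G n"] show "AE x in block \<alpha>. 0 \<le> \<Phi> (G n) x"
      by eventually_elim (simp add: u(2)[OF \<alpha>] Gn)
  qed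
  have inc: "AE x in M. incseq (\<lambda>n. \<Phi> (G n) x) \<and> (\<lambda>n. \<Phi> (G n) x) \<longlonglongrightarrow> \<bar>\<Phi> g x\<bar>"
    unfolding AE_on_partition_iff[OF I partition]
  proof
    fix \<alpha> assume \<alpha>: "\<alpha> \<in> I"
    with lim have *: "incseq (\<lambda>n. G n \<alpha>)" "(\<lambda>n. G n \<alpha>) \<longlonglongrightarrow> \<bar>g \<alpha>\<bar>"
      by (simp_all add: AE_count_space)
    have "AE x in block \<alpha>. \<forall>n. \<Phi> (G n) x = G n \<alpha> * u \<alpha> x"
      using \<Phi>[OF \<alpha>] by (simp add: AE_all_countable)
    with \<Phi>[OF \<alpha>, of g]
    show "AE x in block \<alpha>. incseq (\<lambda>n. \<Phi> (G n) x) \<and> (\<lambda>n. \<Phi> (G n) x) \<longlonglongrightarrow> \<bar>\<Phi> g x\<bar>"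
    proof eventually_elim
      case (elim x)
      then show ?case
        using * u(2)[OF \<alpha>, of x]
        by (auto simp: abs_mult incseq_def intro!: tendsto_mult_right mult_right_mono)
    qed
  qed
  have bdd': "bdd_above (range (\<lambda>n. NKH (\<Phi> (G n))))"
    using bdd by (simp add: \<Phi>_KH(2)[OF G])
  note * = FatouD[where F = "\<lambda>n. \<Phi> (G n)", OF FKH \<Phi>_meas \<Phi>_KH(1)[OF G] pos inc bdd']
  have gE: "g \<in> E"
    by (rule ideal_space_AE_abs_eq(1)[OF E _ KHD(3)[OF *(1)]]) (auto simp: AE_count_space \<Phi>_block(2))
  with *(2) show "g \<in> E \<and> (\<lambda>n. NE (G n)) \<longlonglongrightarrow> NE g"
    by (simp add: \<Phi>_KH(2) G)
qed

text \<open>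
  Extension by zero multiplies the norm of \<open>X\<^sub>\<alpha>\<close> by the norm of the unit vector \<open>e\<^sub>\<alpha>\<close>, which is
  positive and can be cancelled from the limit.
\<close>
theorem Fatou_block:
  assumes FKH: "Fatou_property M KH NKH" and \<alpha>: "\<alpha> \<in> I"
  shows "Fatou_property (block \<alpha>) (X \<alpha>) (NX \<alpha>)"
proof (rule FatouI)
  fix f and F :: "nat \<Rightarrow> 'a \<Rightarrow> real"
  assume f: "f \<in> borel_measurable (block \<alpha>)" and F: "\<And>n. F n \<in> X \<alpha>"
    and nonneg: "\<And>n. AE x in block \<alpha>. 0 \<le> F n x"
    and lim: "AE x in block \<alpha>. incseq (\<lambda>n. F n x) \<and> (\<lambda>n. F n x) \<longlonglongrightarrow> \<bar>f x\<bar>"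
    and bdd: "bdd_above (range (\<lambda>n. NX \<alpha> (F n)))"
  define Z where "Z v x = v x * indicator (\<Omega> \<alpha>) x" for v :: "'a \<Rightarrow> real" and x
  note e = ideal_space_unit_vector[OF E \<alpha>]
  have Z_meas: "Z v \<in> borel_measurable M" if "v \<in> borel_measurable (block \<alpha>)" for v
    using that block_sets[OF \<alpha>] sets.sets_into_space[OF block_sets[OF \<alpha>]]
    by (simp add: borel_measurable_restrict_space_iff Z_def[abs_def] mult.commute)
  have Z_zero: "AE x in block \<beta>. Z v x = 0" if "\<beta> \<in> I" "\<beta> \<noteq> \<alpha>" for \<beta> v
    using AE_not_in_other_block[OF partition that(1) \<alpha> that(2)] by eventually_elim (simp add: Z_def)
  have Z_eq: "AE x in block \<alpha>. Z v x = v x" for v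
    using AE_in_block by eventually_elim (simp add: Z_def)
  have Z_KH: "Z v \<in> KH" "NKH (Z v) = NX \<alpha> v * NE (indicator {\<alpha>})" if v: "v \<in> X \<alpha>" for v
  proof -
    note vm = Z_meas[OF ideal_space_measurable[OF X[OF \<alpha>] v]]
    have blocks: "(\<lambda>x. Z v x * indicator (\<Omega> \<beta>) x) \<in> X \<beta> \<and>
        block_norms \<Omega> NX (Z v) \<beta> = \<bar>NX \<alpha> v * indicator {\<alpha>} \<beta>\<bar>" if \<beta>: "\<beta> \<in> I" for \<beta>
    proof (cases "\<beta> = \<alpha>")
      case True
      have "AE x in block \<alpha>. \<bar>Z v x\<bar> = \<bar>v x\<bar>"
        using Z_eq[of v] by eventually_elim simp
      with True show ?thesis
        using block_norm_eq[OF \<alpha> vm v] ideal_space_norm_nonneg[OF X[OF \<alpha>] v] by simp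
    next
      case False
      have "AE x in block \<beta>. \<bar>Z v x\<bar> = \<bar>0\<bar>"
        using Z_zero[OF \<beta> False] by eventually_elim simp
      note * = block_norm_eq[OF \<beta> vm ideal_space_zero[OF X[OF \<beta>]] this]
      moreover have "NX \<beta> (\<lambda>x. 0) = 0"
        using ideal_space_norm_zero_iff[OF X[OF \<beta>] ideal_space_zero[OF X[OF \<beta>]]] by simp
      ultimately show ?thesis
        using False by simp
    qed
    note * = KHI[OF vm _ ideal_space_scale[OF E e(1), of "NX \<alpha> v"]]
    show "Z v \<in> KH" "NKH (Z v) = NX \<alpha> v * NE (indicator {\<alpha>})"
      using * blocks ideal_space_norm_nonneg[OF X[OF \<alpha>] v]
      by (simp_all add: ideal_space_norm_scale[OF E e(1)])
  qed
  have pos: "AE x in M. 0 \<le> Z (F n) x" for n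
    using nonneg[of n] block_sets[OF \<alpha>] by (auto simp: AE_restrict_space_iff Z_def indicator_def)
  have inc: "AE x in M. incseq (\<lambda>n. Z (F n) x) \<and> (\<lambda>n. Z (F n) x) \<longlonglongrightarrow> \<bar>Z f x\<bar>"
  proof -
    have "AE x in M. x \<in> \<Omega> \<alpha> \<longrightarrow> incseq (\<lambda>n. F n x) \<and> (\<lambda>n. F n x) \<longlonglongrightarrow> \<bar>f x\<bar>"
      using lim block_sets[OF \<alpha>] by (simp add: AE_restrict_space_iff del: AE_conj_iff)
    then show ?thesis
      by eventually_elim (auto simp: Z_def indicator_def incseq_def)
  qed
  have bdd': "bdd_above (range (\<lambda>n. NKH (Z (F n))))"
  proof -
    obtain K where "\<And>n. NX \<alpha> (F n) \<le> K"
      using bdd by (auto simp: bdd_above_def)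
    then have "NKH (Z (F n)) \<le> K * NE (indicator {\<alpha>})" for n
      using e(2) by (simp add: Z_KH(2)[OF F])
    then show ?thesis
      by (auto simp: bdd_above_def)
  qed
  note * = FatouD[where F = "\<lambda>n. Z (F n)", OF FKH Z_meas[OF f] Z_KH(1)[OF F] pos inc bdd']
  have "AE x in block \<alpha>. \<bar>f x\<bar> = \<bar>Z f x * indicator (\<Omega> \<alpha>) x\<bar>"
    using AE_in_block by eventually_elim (simp add: Z_def)
  then have fX: "f \<in> X \<alpha>"
    by (rule ideal_space_AE_abs_eq(1)[OF X[OF \<alpha>] f KHD(2)[OF *(1) \<alpha>]])
  from *(2) have "(\<lambda>n. NX \<alpha> (F n) * NE (indicator {\<alpha>})) \<longlonglongrightarrow> NX \<alpha> f * NE (indicator {\<alpha>})"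
    by (simp add: Z_KH(2) F fX)
  then have "(\<lambda>n. NX \<alpha> (F n)) \<longlonglongrightarrow> NX \<alpha> f"
    using e(2) by (simp add: tendsto_mult_right_iff)
  with fX show "f \<in> X \<alpha> \<and> (\<lambda>n. NX \<alpha> (F n)) \<longlonglongrightarrow> NX \<alpha> f"
    by blast
qed

end

theorem theorem3p10:
  fixes M :: "'a measure"
    and I :: "'i set"
    and \<Omega> :: "'i \<Rightarrow> 'a set"
    and X :: "'i \<Rightarrow> ('a \<Rightarrow> real) set"
    and NX :: "'i \<Rightarrow> ('a \<Rightarrow> real) \<Rightarrow> real"
    and E :: "('i \<Rightarrow> real) set"
    and NE :: "('i \<Rightarrow> real) \<Rightarrow> real"
  assumes "sigma_finite_measure M"
    and "complete_measure M"
    and "countable I"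
    and "measurable_partition M I \<Omega>"
    and "\<And>\<alpha>. \<alpha> \<in> I \<Longrightarrow> quasi_normed_ideal_space (restrict_space M (\<Omega> \<alpha>)) (X \<alpha>) (NX \<alpha>)"
    and "\<And>\<alpha>. \<alpha> \<in> I \<Longrightarrow> nontrivial_space (restrict_space M (\<Omega> \<alpha>)) (X \<alpha>)"
    and "bdd_above ((\<lambda>\<alpha>. modulus_of_concavity (X \<alpha>) (NX \<alpha>)) ` I)"
    and "quasi_normed_ideal_space (count_space I) E NE"
  shows "Fatou_property M (Koethe_Herz_space M I \<Omega> E X NX) (Koethe_Herz_norm \<Omega> NE NX) \<longleftrightarrow>
         Fatou_property (count_space I) E NE \<and>
         (\<forall>\<alpha>\<in>I. Fatou_property (restrict_space M (\<Omega> \<alpha>)) (X \<alpha>) (NX \<alpha>))"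
proof -
  interpret koethe_herz M I \<Omega> X NX E NE
    by unfold_locales (fact assms)+
  show ?thesis
    using Fatou_KH Fatou_sequence_space Fatou_block assms(6) by blast
qed

end
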